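(* The following hold: (i) If $\limsup_{t\to\infty}\mu(t)/\log t<1/\ell$, then $D<\infty$ almost surely. (ii) If $\liminf_{t\to\infty}\mu(t)/\log t>1/\ell$, then $\mathbb{P}(D=\infty)>0$.
   Context: Let $\ell>0$ be fixed. $\mathcal N$ is an inhomogeneous Poisson point process on $(0,\infty)$ with rate function $\mu(t)$, i.e. with intensity measure $\mu(t)\,\mathrm{d}t$; write $M(a,b)=\int_a^b\mu(t)\,\mathrm{d}t$. It is assumed that $M(0,t)<\infty$ for every finite $t$ and that $\mu(t)>0$ for Lebesgue-almost all $t\ge 0$. Let $0<T_1<T_2<\cdots$ be the epochs (points) of $\mathcal N$, with $T_0=0$ by convention; if $\mathcal N$ has only finitely many points, say $n$ of them, then $T_{n+1}=\infty$. Define $D=\min\{T_n:\ n\ge 0,\ T_{n+1}-T_n\ge \ell\}$, with $D=\infty$ if there is no such $n$. *)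

theory Defs
  imports "HOL-Probability.Probability"
begin

definition rate_mass :: "(real \<Rightarrow> real) \<Rightarrow> real set \<Rightarrow> ennreal" where
  "rate_mass \<mu> A = (\<integral>\<^sup>+t\<in>A. ennreal (\<mu> t) \<partial>lborel)"

text \<open>
  An inhomogeneous Poisson point process on the half-line of positive reals, as a random locally
  finite set of points \<^term>\<open>N \<omega>\<close>. A Poisson process with an intensity measure that has a density
  is simple, so that a set (rather than a multiset) of points is enough. The counts are only
  prescribed on bounded Borel sets: there they are finite, so that \<^const>\<open>card\<close> really counts,
  and this determines the law of the process. The values of \<^term>\<open>\<mu>\<close> outside the positive
  reals play no role.
\<close>

locale poisson_point_process = prob_space P
  for P :: "'w measure" +
  fixes N :: "'w \<Rightarrow> real set" and \<mu> :: "real \<Rightarrow> real"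
  assumes rate_measurable: "\<mu> \<in> borel_measurable (restrict_space borel {0<..})"
    and rate_nonneg: "\<And>t. 0 < t \<Longrightarrow> 0 \<le> \<mu> t"
    and rate_locally_finite: "\<And>t. rate_mass \<mu> {0<..t} < \<infinity>"
    and points_pos: "\<And>\<omega>. \<omega> \<in> space P \<Longrightarrow> N \<omega> \<subseteq> {0<..}"
    and points_locally_finite: "\<And>\<omega> t. \<omega> \<in> space P \<Longrightarrow> finite (N \<omega> \<inter> {0<..t})"
    and count_poisson:
      "\<And>A t k. A \<in> sets borel \<Longrightarrow> A \<subseteq> {0<..t} \<Longrightarrow>
         \<P>(\<omega> in P. card (N \<omega> \<inter> A) = k) =
         enn2real (rate_mass \<mu> A) ^ k / fact k * exp (- enn2real (rate_mass \<mu> A))"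
    and count_indep:
      "\<And>(A :: nat \<Rightarrow> real set) n t.
         (\<And>i. i < n \<Longrightarrow> A i \<in> sets borel \<and> A i \<subseteq> {0<..t}) \<Longrightarrow>
         disjoint_family_on A {..<n} \<Longrightarrow>
         indep_vars (\<lambda>_. count_space UNIV) (\<lambda>i \<omega>. card (N \<omega> \<inter> A i)) {..<n}"

text \<open>
  The epochs of a locally finite set of positive points, with zeroth epoch 0. The infimum over the
  empty set is infinite, so that after the last point all epochs are infinite.
\<close>

primrec epoch :: "real set \<Rightarrow> nat \<Rightarrow> ereal" where
  "epoch S 0 = 0"
| "epoch S (Suc n) = Inf {ereal x | x. x \<in> S \<and> epoch S n < ereal x}"

definition gap_epochs :: "real \<Rightarrow> real set \<Rightarrow> ereal set" where
  "gap_epochs l S = {epoch S n | n. epoch S n < \<infinity> \<and> ereal l \<le> epoch S (Suc n) - epoch S n}"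

text \<open>
  The infimum is a minimum whenever the set is nonempty (see below), and infinite otherwise.
\<close>

definition first_gap :: "real \<Rightarrow> real set \<Rightarrow> ereal" where
  "first_gap l S = Inf (gap_epochs l S)"

lemma epoch_mono: "m \<le> n \<Longrightarrow> epoch S m \<le> epoch S n"
proof (rule lift_Suc_mono_le[of "epoch S"])
  show "epoch S i \<le> epoch S (Suc i)" for i
    by (auto intro!: Inf_greatest)
qed

lemma first_gap_is_minimum:
  assumes "gap_epochs l S \<noteq> {}"
  shows "first_gap l S \<in> gap_epochs l S"
proof -
  let ?Q = "\<lambda>n. epoch S n < \<infinity> \<and> ereal l \<le> epoch S (Suc n) - epoch S n"
  define m where "m = (LEAST n. ?Q n)"
  from assms have "\<exists>n. ?Q n" by (auto simp: gap_epochs_def)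
  then have Q: "?Q m" unfolding m_def by (rule LeastI_ex)
  then have mem: "epoch S m \<in> gap_epochs l S" unfolding gap_epochs_def by blast
  have "epoch S m \<le> x" if x: "x \<in> gap_epochs l S" for x
  proof -
    from x obtain n where n: "x = epoch S n" "?Q n" unfolding gap_epochs_def by blast
    have "m \<le> n" unfolding m_def by (rule Least_le) (rule n(2))
    then show ?thesis unfolding n(1) by (rule epoch_mono)
  qed
  then have "first_gap l S = epoch S m"
    unfolding first_gap_def by (intro antisym Inf_lower Inf_greatest mem)
  with mem show ?thesis by simp
qed

end

theory Submission
  imports Defs
begin

text \<open>
  There is no gap of length at least \<open>l\<close> between consecutive epochs exactly if every open window
  \<open>(t, t + l)\<close> with \<open>t \<ge> 0\<close> contains a point of the process (\<open>first_gap_infinite_iff\<close>). Hence both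
  claims concern the empty windows, and a set \<open>A\<close> is empty of points with probability
  \<open>exp (- rate_mass \<mu> A)\<close>. For a rate \<open>c ln t\<close> a window of length \<open>l\<close> near \<open>t\<close> is therefore
  empty with probability about \<open>t powr (- c l)\<close>, which is summable along an arithmetic progression
  exactly if \<open>c l > 1\<close>.

  If \<open>\<mu> t \<le> ln t / l\<close> eventually, the consecutive disjoint intervals of length \<open>l\<close> are empty
  independently and with probabilities that dominate a harmonic series, so that almost surely one of
  them is empty (\<open>AE_first_gap_finite\<close>, the divergence half of Borel--Cantelli).

  If \<open>\<mu> t \<ge> c ln t\<close> eventually with \<open>c l > 1\<close>, the windows are replaced by countably many slightly
  shorter ones that start on a fine grid, such that every window of length \<open>l\<close> contains one of them
  and the void probabilities are still summable. Beyond some grid index \<open>K\<close> they sum to less than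
  one half. The first \<open>K\<close> grid cells are all hit with positive probability because
  \<open>\<mu>\<close> is positive almost everywhere, and this event is independent of the emptiness of any single
  later window. A union bound within this event leaves a positive probability that all windows are
  hit (\<open>prob_first_gap_infinite_pos\<close>). The later windows overlap one another; by the union bound
  only one of them at a time is compared with the cells, so that all sets involved are disjoint.
\<close>

section \<open>Gaps between epochs and empty windows\<close>

lemma epoch_nonneg: "0 \<le> epoch S n"
  using epoch_mono[of 0 n S] by simp

text \<open>
  By local finiteness the infimum that defines the next epoch is a minimum over finitely many points
  as soon as it is finite.
\<close>

lemma epoch_Suc_attained:
  assumes fin: "\<And>t. finite (S \<inter> {0<..t})" and pos: "S \<subseteq> {0<..}"
    and le: "epoch S (Suc n) \<le> ereal t"
  shows "\<exists>x\<in>S \<inter> {0<..t}. epoch S (Suc n) = ereal x \<and> epoch S n < ereal x"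
proof -
  define F where "F = {x \<in> S \<inter> {0<..t+1}. epoch S n < ereal x}"
  have finF: "finite F" unfolding F_def using fin[of "t+1"] by (rule finite_subset[rotated]) auto
  have "epoch S (Suc n) < ereal (t+1)"
    using le by (rule order_le_less_trans) simp
  then obtain z where "z \<in> S" "epoch S n < ereal z" "z < t + 1"
    by (auto simp: Inf_less_iff)
  with pos have "z \<in> F" by (auto simp: F_def)
  then have MF: "Min F \<in> F" using finF by (intro Min_in) auto
  have "epoch S (Suc n) = ereal (Min F)"
  proof (rule antisym)
    show "epoch S (Suc n) \<le> ereal (Min F)"
      using MF by (auto simp: F_def intro!: Inf_lower)
    show "ereal (Min F) \<le> epoch S (Suc n)"
      unfolding epoch.simps
    proof (rule Inf_greatest, clarify)
      fix x assume x: "x \<in> S" "epoch S n < ereal x"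
      show "ereal (Min F) \<le> ereal x"
      proof (cases "x \<le> t + 1")
        case True
        then have "x \<in> F" using x pos by (auto simp: F_def)
        then show ?thesis using finF by simp
      next
        case False
        then show ?thesis using MF by (auto simp: F_def)
      qed
    qed
  qed
  with MF le show ?thesis by (intro bexI[of _ "Min F"]) (auto simp: F_def)
qed

text \<open>Bounded epochs would be infinitely many distinct points in a bounded interval.\<close>

lemma epoch_exceeds:
  assumes fin: "\<And>t. finite (S \<inter> {0<..t})" and pos: "S \<subseteq> {0<..}"
  shows "\<exists>n. ereal t < epoch S n"
proof (rule ccontr)
  assume "\<not> ?thesis"
  then have le: "epoch S n \<le> ereal t" for n by (auto simp: not_less)
  have "epoch S n < epoch S (Suc n)" for n
    using epoch_Suc_attained[OF fin pos le[of "Suc n"]] by (metis (no_types, lifting))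
  then have "strict_mono (epoch S)"
    by (simp add: strict_mono_Suc_iff del: epoch.simps)
  then have "inj (\<lambda>n. epoch S (Suc n))"
    by (intro injI) (simp add: strict_mono_eq del: epoch.simps)
  moreover have "range (\<lambda>n. epoch S (Suc n)) \<subseteq> ereal ` (S \<inter> {0<..t})"
    using epoch_Suc_attained[OF fin pos le] by blast
  ultimately show False
    using fin[of t] by (meson finite_imageI finite_subset infinite_UNIV_nat finite_imageD)
qed

text \<open>
  An empty window \<open>(t, t + l)\<close> lies between the last epoch up to \<open>t\<close> and the next one, which are
  then at least \<open>l\<close> apart; conversely, a gap of length at least \<open>l\<close> after an epoch \<open>t\<close> makes \<open>(t, t + l)\<close>
  empty.
\<close>

lemma first_gap_infinite_iff:
  assumes fin: "\<And>t. finite (S \<inter> {0<..t})" and pos: "S \<subseteq> {0<..}"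
  shows "first_gap l S = \<infinity> \<longleftrightarrow> (\<forall>t\<ge>0. \<exists>y\<in>S. t < y \<and> y < t + l)"
proof
  assume inf: "first_gap l S = \<infinity>"
  show "\<forall>t\<ge>0. \<exists>y\<in>S. t < y \<and> y < t + l"
  proof (intro allI impI, rule ccontr)
    fix t :: real assume t: "0 \<le> t" and no: "\<not> (\<exists>y\<in>S. t < y \<and> y < t + l)"
    define n where "n = (LEAST n. ereal t < epoch S n)"
    have n: "ereal t < epoch S n"
      unfolding n_def by (rule LeastI_ex) (rule epoch_exceeds[OF fin pos])
    have "n \<noteq> 0" using n t by (cases n) auto
    then obtain k where k: "n = Suc k" using not0_implies_Suc by blast
    have kt: "epoch S k \<le> ereal t"
      using not_less_Least[of k "\<lambda>n. ereal t < epoch S n"] k n_def by (auto simp: not_less)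
    have "ereal (t + l) \<le> epoch S (Suc k)"
      unfolding epoch.simps
    proof (rule Inf_greatest, clarify)
      fix x assume x: "x \<in> S" "epoch S k < ereal x"
      then have "epoch S (Suc k) \<le> ereal x" by (auto intro: Inf_lower)
      then have "ereal t < ereal x" using n k by (metis order_less_le_trans)
      then show "ereal (t + l) \<le> ereal x" using no x by force
    qed
    moreover obtain e where e: "epoch S k = ereal e" "e \<le> t"
      using kt epoch_nonneg[of S k] by (cases "epoch S k") auto
    ultimately have "ereal l \<le> epoch S (Suc k) - epoch S k"
      by (cases "epoch S (Suc k)") auto
    then have "epoch S k \<in> gap_epochs l S"
      unfolding gap_epochs_def using e by (intro CollectI exI[of _ k]) (auto simp del: epoch.simps)
    then have "first_gap l S \<le> ereal e" unfolding first_gap_def e(1) by (rule Inf_lower)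
    with inf show False by simp
  qed
next
  assume near: "\<forall>t\<ge>0. \<exists>y\<in>S. t < y \<and> y < t + l"
  have "gap_epochs l S = {}"
  proof (rule ccontr)
    assume "gap_epochs l S \<noteq> {}"
    then obtain n where n: "epoch S n < \<infinity>" "ereal l \<le> epoch S (Suc n) - epoch S n"
      unfolding gap_epochs_def by auto
    obtain t where t: "epoch S n = ereal t" "0 \<le> t"
      using n(1) epoch_nonneg[of S n] by (cases "epoch S n") auto
    obtain y where y: "y \<in> S" "t < y" "y < t + l" using near t by blast
    have "epoch S (Suc n) \<le> ereal y"
      using y t by (auto intro!: Inf_lower)
    with n(2) t y show False
      by (cases "epoch S (Suc n)") auto
  qed
  then show "first_gap l S = \<infinity>" by (simp add: first_gap_def top_ereal_def)
qed

text \<open>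
  This serves to show that \<open>first_gap\<close> is infinite on a measurable set. Restricting the windows of
  length \<open>l\<close> to rational left end points would miss a gap of length exactly \<open>l\<close>. On a bounded range
  there are only finitely many gaps, so that if all are shorter than \<open>l\<close> then they are shorter than
  some rational \<open>r < l\<close>, and for the windows of length \<open>r\<close> rational end points do suffice.
\<close>

lemma every_window_hit_iff_rational:
  fixes l :: real
  assumes fin: "\<And>t. finite (S \<inter> {0<..t})" and pos: "S \<subseteq> {0<..}"
  shows "(\<forall>t\<ge>0. \<exists>y\<in>S. t < y \<and> y < t + l) \<longleftrightarrow>
    (\<forall>k::nat. \<exists>r\<in>\<rat> \<inter> {..<l}. \<forall>q\<in>\<rat> \<inter> {0..real k}. S \<inter> {q<..q + r} \<noteq> {})"
proof
  assume near: "\<forall>t\<ge>0. \<exists>y\<in>S. t < y \<and> y < t + l"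
  show "\<forall>k::nat. \<exists>r\<in>\<rat> \<inter> {..<l}. \<forall>q\<in>\<rat> \<inter> {0..real k}. S \<inter> {q<..q + r} \<noteq> {}"
  proof
    fix k :: nat
    define F where "F = insert 0 (S \<inter> {0<..real k})"
    have F: "finite F" "0 \<in> F" using fin by (auto simp: F_def)
    \<comment> \<open>\<open>g\<close> picks for each point some later point at distance less than \<open>l\<close>, not necessarily the next.\<close>
    obtain g where g: "g x \<in> S" "x < g x" "g x < x + l" if "x \<in> F" for x
      using near unfolding F_def
      by (metis greaterThanAtMost_iff insertE IntE less_eq_real_def order_refl)
    define m where "m = Max ((\<lambda>x. g x - x) ` F)"
    have m: "g x - x \<le> m" if "x \<in> F" for x
      unfolding m_def using F that by (intro Max_ge) auto
    have "m \<in> (\<lambda>x. g x - x) ` F" unfolding m_def using F by (intro Max_in) auto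
    then have "m < l" using g by (auto simp: algebra_simps)
    then obtain r where r: "r \<in> \<rat>" "m < r" "r < l" using Rats_dense_in_real by blast
    have hit: "S \<inter> {q<..q + r} \<noteq> {}" if q: "0 \<le> q" "q \<le> real k" for q
    proof -
      define x where "x = Max (F \<inter> {..q})"
      have x: "x \<in> F \<inter> {..q}" unfolding x_def using F q by (intro Max_in) auto
      have "q < g x"
      proof (rule ccontr)
        assume "\<not> q < g x"
        then have "g x \<in> F \<inter> {..q}" using x g[of x] q pos by (auto simp: F_def)
        then have "g x \<le> x" unfolding x_def using F by (intro Max_ge) auto
        then show False using g[of x] x by auto
      qed
      moreover have "g x \<le> q + r" using m[of x] x r by auto
      ultimately show ?thesis using g[of x] x by auto
    qed
    show "\<exists>r\<in>\<rat> \<inter> {..<l}. \<forall>q\<in>\<rat> \<inter> {0..real k}. S \<inter> {q<..q + r} \<noteq> {}"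
    proof
      show "\<forall>q\<in>\<rat> \<inter> {0..real k}. S \<inter> {q<..q + r} \<noteq> {}" using hit by simp
    qed (use r in simp)
  qed
next
  assume *: "\<forall>k::nat. \<exists>r\<in>\<rat> \<inter> {..<l}. \<forall>q\<in>\<rat> \<inter> {0..real k}. S \<inter> {q<..q + r} \<noteq> {}"
  show "\<forall>t\<ge>0. \<exists>y\<in>S. t < y \<and> y < t + l"
  proof (intro allI impI)
    fix t :: real assume t: "0 \<le> t"
    obtain k :: nat where k: "t < real k" using reals_Archimedean2 by blast
    obtain r where r: "r < l" "\<forall>q\<in>\<rat> \<inter> {0..real k}. S \<inter> {q<..q + r} \<noteq> {}" using * by blast
    obtain q where q: "q \<in> \<rat>" "t < q" "q < min (real k) (t + (l - r))"
      using Rats_dense_in_real[of t "min (real k) (t + (l - r))"] k r by auto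
    then obtain y where "y \<in> S" "q < y" "y \<le> q + r" using r(2) t by fastforce
    with q show "\<exists>y\<in>S. t < y \<and> y < t + l" by (intro bexI[of _ y]) auto
  qed
qed

section \<open>Counting events of the process\<close>

context poisson_point_process
begin

lemma finite_points_bounded:
  assumes "\<omega> \<in> space P" "A \<subseteq> {0<..t}"
  shows "finite (N \<omega> \<inter> A)"
  using points_locally_finite[OF assms(1), of t] by (rule finite_subset[rotated]) (use assms in auto)

lemma measurable_count:
  assumes "A \<in> sets borel" "A \<subseteq> {0<..t}"
  shows "(\<lambda>\<omega>. card (N \<omega> \<inter> A)) \<in> measurable P (count_space UNIV)"
proof -
  have "indep_vars (\<lambda>_. count_space UNIV) (\<lambda>i \<omega>. card (N \<omega> \<inter> A)) {..<1::nat}"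
    using assms by (intro count_indep[where t = t]) (auto simp: disjoint_family_on_def)
  then show ?thesis by (simp add: indep_vars_def)
qed

lemma event_count:
  assumes "A \<in> sets borel" "A \<subseteq> {0<..t}"
  shows "{\<omega>\<in>space P. card (N \<omega> \<inter> A) \<in> Q} \<in> events"
  using measurable_sets[OF measurable_count[OF assms], of Q]
  by (simp add: vimage_def Int_def conj_commute)

lemma event_hit:
  assumes "A \<in> sets borel" "A \<subseteq> {0<..t}"
  shows "{\<omega>\<in>space P. N \<omega> \<inter> A \<noteq> {}} \<in> events"
proof -
  have "{\<omega>\<in>space P. N \<omega> \<inter> A \<noteq> {}} = {\<omega>\<in>space P. card (N \<omega> \<inter> A) \<in> - {0}}"
    using finite_points_bounded[OF _ assms(2)] by (intro Collect_cong)
      (auto simp only: card_eq_0_iff Compl_iff singleton_iff)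
  then show ?thesis using event_count[OF assms, of "- {0}"] by metis
qed

lemma event_first_gap_infinite: "{\<omega>\<in>space P. first_gap l (N \<omega>) = \<infinity>} \<in> events"
proof -
  have [measurable]: "{\<omega>\<in>space P. N \<omega> \<inter> {q<..q + r} \<noteq> {}} \<in> events" if "0 \<le> q" for q r
    using that by (intro event_hit[where t = "q + r"]) auto
  have cr: "countable (\<rat> \<inter> A)" for A :: "real set" using countable_rat by auto
  have "{\<omega>\<in>space P. first_gap l (N \<omega>) = \<infinity>} = {\<omega>\<in>space P. \<forall>k::nat. \<exists>r\<in>\<rat> \<inter> {..<l}.
      \<forall>q\<in>\<rat> \<inter> {0..real k}. N \<omega> \<inter> {q<..q + r} \<noteq> {}}"
    using points_pos points_locally_finite
    by (intro Collect_cong conj_cong refl)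
      (simp only: first_gap_infinite_iff every_window_hit_iff_rational)
  also have "\<dots> \<in> events"
    by (intro sets.sets_Collect_countable_All sets.sets_Collect_countable_Ex'
        sets.sets_Collect_countable_All' cr) auto
  finally show ?thesis .
qed

lemma prob_counts_eq_prod:
  fixes A :: "nat \<Rightarrow> real set" and Q :: "nat \<Rightarrow> nat set"
  assumes A: "\<And>i. i < n \<Longrightarrow> A i \<in> sets borel \<and> A i \<subseteq> {0<..t}"
    and disj: "disjoint_family_on A {..<n}"
  shows "\<P>(\<omega> in P. \<forall>i<n. card (N \<omega> \<inter> A i) \<in> Q i) =
    (\<Prod>i<n. \<P>(\<omega> in P. card (N \<omega> \<inter> A i) \<in> Q i))"
proof (cases "n = 0")
  case True
  then show ?thesis by (simp add: prob_space)
next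
  case False
  have "prob (\<Inter>i\<in>{..<n}. (\<lambda>\<omega>. card (N \<omega> \<inter> A i)) -` Q i \<inter> space P) =
    (\<Prod>i<n. prob ((\<lambda>\<omega>. card (N \<omega> \<inter> A i)) -` Q i \<inter> space P))"
    using False by (intro indep_varsD[OF count_indep[OF A disj]]) auto
  moreover have "(\<Inter>i\<in>{..<n}. (\<lambda>\<omega>. card (N \<omega> \<inter> A i)) -` Q i \<inter> space P) =
    {\<omega>\<in>space P. \<forall>i<n. card (N \<omega> \<inter> A i) \<in> Q i}"
    using False by auto
  moreover have "(\<lambda>\<omega>. card (N \<omega> \<inter> A i)) -` Q i \<inter> space P = {\<omega>\<in>space P. card (N \<omega> \<inter> A i) \<in> Q i}" for i
    by auto
  ultimately show ?thesis by simp
qed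

lemma prob_void:
  assumes "A \<in> sets borel" "A \<subseteq> {0<..t}"
  shows "\<P>(\<omega> in P. card (N \<omega> \<inter> A) = 0) = exp (- enn2real (rate_mass \<mu> A))"
  using count_poisson[OF assms, of 0] by simp

lemma prob_hit:
  assumes "A \<in> sets borel" "A \<subseteq> {0<..t}"
  shows "\<P>(\<omega> in P. card (N \<omega> \<inter> A) \<noteq> 0) = 1 - exp (- enn2real (rate_mass \<mu> A))"
  using prob_neg[of "\<lambda>\<omega>. card (N \<omega> \<inter> A) = 0"] event_count[OF assms, of "{0}"] prob_void[OF assms]
  by simp

lemma rate_mass_interval_finite:
  assumes "0 \<le> a" shows "rate_mass \<mu> {a<..b} < \<infinity>"
proof -
  have "rate_mass \<mu> {a<..b} \<le> rate_mass \<mu> {0<..b}"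
    unfolding rate_mass_def using assms
    by (intro nn_integral_mono) (auto split: split_indicator)
  then show ?thesis using rate_locally_finite by (rule order_le_less_trans)
qed

lemma prob_void_interval_ge:
  assumes "0 \<le> a" "a \<le> b" "0 \<le> r" "\<And>t. a < t \<Longrightarrow> t \<le> b \<Longrightarrow> \<mu> t \<le> r"
  shows "exp (- (r * (b - a))) \<le> \<P>(\<omega> in P. card (N \<omega> \<inter> {a<..b}) = 0)"
proof -
  have "rate_mass \<mu> {a<..b} \<le> (\<integral>\<^sup>+t. ennreal r * indicator {a<..b} t \<partial>lborel)"
    unfolding rate_mass_def using assms
    by (intro nn_integral_mono) (auto split: split_indicator intro: ennreal_leI)
  also have "\<dots> = ennreal (r * (b - a))"
    using assms by (simp add: nn_integral_cmult_indicator ennreal_mult)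
  finally have "enn2real (rate_mass \<mu> {a<..b}) \<le> r * (b - a)"
    using assms by (intro enn2real_leI) auto
  then show ?thesis using assms by (subst prob_void[where t = b]) auto
qed

lemma prob_void_interval_le:
  assumes "0 \<le> a" "a \<le> b" "0 \<le> r" "\<And>t. a < t \<Longrightarrow> t \<le> b \<Longrightarrow> r \<le> \<mu> t"
  shows "\<P>(\<omega> in P. card (N \<omega> \<inter> {a<..b}) = 0) \<le> exp (- (r * (b - a)))"
proof -
  have "ennreal (r * (b - a)) = (\<integral>\<^sup>+t. ennreal r * indicator {a<..b} t \<partial>lborel)"
    using assms by (simp add: nn_integral_cmult_indicator ennreal_mult)
  also have "\<dots> \<le> rate_mass \<mu> {a<..b}"
    unfolding rate_mass_def using assms
    by (intro nn_integral_mono) (auto split: split_indicator intro: ennreal_leI)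
  finally have "enn2real (ennreal (r * (b - a))) \<le> enn2real (rate_mass \<mu> {a<..b})"
    using rate_mass_interval_finite[OF assms(1)] by (intro enn2real_mono) auto
  then show ?thesis using assms by (subst prob_void[where t = b]) auto
qed

text \<open>
  Positivity of the rate almost everywhere gives every nonempty interval a positive mass, and thus
  allows it to contain a point.
\<close>

lemma prob_hit_interval_pos:
  assumes pos: "AE t in lborel. 0 \<le> t \<longrightarrow> 0 < \<mu> t" and "0 \<le> a" "a < b"
  shows "0 < \<P>(\<omega> in P. card (N \<omega> \<inter> {a<..b}) \<noteq> 0)"
proof -
  have m: "(\<lambda>t. ennreal (\<mu> t) * indicator {a<..b} t) \<in> borel_measurable lborel"
  proof -
    have "(\<lambda>t. ennreal (\<mu> t)) \<in> borel_measurable (restrict_space borel {0<..})"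
      using rate_measurable by measurable
    then have "(\<lambda>t. ennreal (\<mu> t) * indicator {0<..} t) \<in> borel_measurable borel"
      by (subst (asm) borel_measurable_restrict_space_iff_ennreal) auto
    then have "(\<lambda>t. (ennreal (\<mu> t) * indicator {0<..} t) * indicator {a<..b} t) \<in> borel_measurable borel"
      by measurable
    also have "(\<lambda>t. (ennreal (\<mu> t) * indicator {0<..} t) * indicator {a<..b} t) =
        (\<lambda>t. ennreal (\<mu> t) * indicator {a<..b} t)"
      using assms by (auto split: split_indicator)
    finally show ?thesis by simp
  qed
  have "rate_mass \<mu> {a<..b} \<noteq> 0"
  proof
    assume "rate_mass \<mu> {a<..b} = 0"
    then have "AE t in lborel. ennreal (\<mu> t) * indicator {a<..b} t = 0"
      unfolding rate_mass_def by (subst (asm) nn_integral_0_iff_AE[OF m])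
    with pos have "AE t in lborel. t \<notin> {a<..b}"
      by eventually_elim (use assms in \<open>auto split: split_indicator_asm simp: ennreal_eq_0_iff\<close>)
    then have "emeasure lborel {a<..b} = 0"
      by (subst (asm) AE_iff_measurable[of "{a<..b}"]) auto
    then show False using assms by simp
  qed
  then have "0 < enn2real (rate_mass \<mu> {a<..b})"
    using rate_mass_interval_finite[OF assms(2)] by (simp add: enn2real_positive_iff zero_less_iff_neq_zero)
  then show ?thesis using assms by (subst prob_hit[where t = b]) auto
qed

section \<open>Slowly growing rates\<close>

text \<open>
  The bound \<open>ln t / l\<close> is just small enough: over an interval of length \<open>l\<close> that ends at \<open>b\<close> the
  mass is at most \<open>ln b\<close>, so that the interval is empty with probability at least \<open>1 / b\<close>. These
  lower bounds form a harmonic series, and independence turns its divergence into the almost sure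
  occurrence of an empty interval.
\<close>

lemma AE_first_gap_finite:
  assumes l: "0 < l" and upper: "eventually (\<lambda>t. \<mu> t \<le> ln t / l) at_top"
  shows "AE \<omega> in P. first_gap l (N \<omega>) < \<infinity>"
proof -
  obtain T where T: "\<And>t. T \<le> t \<Longrightarrow> \<mu> t \<le> ln t / l"
    using upper by (auto simp: eventually_at_top_linorder)
  obtain k0 :: nat where k0: "max T 1 / l < real k0" using reals_Archimedean2 by blast
  define a where "a k = real (k + k0) * l" for k
  define I where "I k = {a k<..a (Suc k)}" for k
  have a_ge: "T \<le> a k" "1 \<le> a k" for k
  proof -
    have "max T 1 \<le> real k0 * l" using k0 l by (simp add: field_simps)
    also have "\<dots> \<le> a k" using l by (simp add: a_def)
    finally show "T \<le> a k" "1 \<le> a k" by auto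
  qed
  have a_Suc: "a (Suc k) = a k + l" for k by (simp add: a_def algebra_simps)
  have a_mono: "a i \<le> a j" if "i \<le> j" for i j using that l by (simp add: a_def)
  have I: "I k \<in> sets borel" "I k \<subseteq> {0<..a n}" if "k < n" for k n
    using a_ge[of k] a_mono[of "Suc k" n] that by (auto simp: I_def)
  have disj: "disjoint_family_on I {..<n}" for n
  proof -
    have "I i \<inter> I j = {}" if "i < j" for i j
      using a_mono[of "Suc i" j] that by (auto simp: I_def)
    then show ?thesis unfolding disjoint_family_on_def
      by (metis Int_commute linorder_neqE_nat)
  qed
  have void: "1 / a (Suc k) \<le> \<P>(\<omega> in P. card (N \<omega> \<inter> I k) = 0)" for k
  proof -
    have "exp (- (ln (a (Suc k)) / l * (a (Suc k) - a k))) \<le> \<P>(\<omega> in P. card (N \<omega> \<inter> I k) = 0)"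
      unfolding I_def
    proof (rule prob_void_interval_ge)
      fix t assume t: "a k < t" "t \<le> a (Suc k)"
      then have "\<mu> t \<le> ln t / l" using a_ge[of k] by (intro T) auto
      also have "\<dots> \<le> ln (a (Suc k)) / l"
        using t a_ge[of k] l by (intro divide_right_mono) auto
      finally show "\<mu> t \<le> ln (a (Suc k)) / l" .
    qed (use a_ge[of k] a_ge[of "Suc k"] a_mono[of k "Suc k"] l in auto)
    moreover have "ln (a (Suc k)) / l * (a (Suc k) - a k) = ln (a (Suc k))"
      using l by (simp add: a_Suc)
    ultimately show ?thesis
      using a_ge[of "Suc k"] by (simp add: exp_minus inverse_eq_divide)
  qed
  define H where "H n = {\<omega>\<in>space P. \<forall>k<n. card (N \<omega> \<inter> I k) \<in> - {0}}" for n
  have H_event: "H n \<in> events" for n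
  proof -
    have "H n = {\<omega>\<in>space P. \<forall>k\<in>{..<n}. card (N \<omega> \<inter> I k) \<in> - {0}}" by (auto simp: H_def)
    also have "\<dots> \<in> events"
      by (intro sets.sets_Collect_finite_All event_count[OF I]) auto
    finally show ?thesis .
  qed
  have H_le: "prob (H n) \<le> exp (- (\<Sum>k<n. 1 / a (Suc k)))" for n
  proof -
    have "prob (H n) = (\<Prod>k<n. \<P>(\<omega> in P. card (N \<omega> \<inter> I k) \<in> - {0}))"
      unfolding H_def using I disj by (intro prob_counts_eq_prod[where t = "a n"]) auto
    also have "\<dots> \<le> (\<Prod>k<n. exp (- (1 / a (Suc k))))"
    proof (rule prod_mono, safe)
      fix k assume "k < n"
      have "\<P>(\<omega> in P. card (N \<omega> \<inter> I k) \<in> - {0}) = 1 - \<P>(\<omega> in P. card (N \<omega> \<inter> I k) = 0)"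
        using prob_hit[OF I[of k "Suc k"]] prob_void[OF I[of k "Suc k"]] by simp
      also have "\<dots> \<le> 1 - 1 / a (Suc k)" using void[of k] by simp
      also have "\<dots> \<le> exp (- (1 / a (Suc k)))"
        using exp_ge_add_one_self[of "- (1 / a (Suc k))"] by simp
      finally show "\<P>(\<omega> in P. card (N \<omega> \<inter> I k) \<in> - {0}) \<le> exp (- (1 / a (Suc k)))" .
    qed simp
    also have "\<dots> = exp (- (\<Sum>k<n. 1 / a (Suc k)))" by (simp add: exp_sum sum_negf[symmetric])
    finally show ?thesis .
  qed
  have diverge: "filterlim (\<lambda>n. \<Sum>k<n. 1 / a (Suc k)) at_top sequentially"
  proof -
    have "\<not> summable (\<lambda>k. 1 / a (Suc k))"
    proof
      assume "summable (\<lambda>k. 1 / a (Suc k))"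
      then have "summable (\<lambda>k. l * (1 / a (Suc k)))" by (rule summable_mult)
      moreover have "l * (1 / a (Suc k)) = inverse (real (k + Suc k0))" for k
        using l by (simp add: a_def inverse_eq_divide)
      ultimately have "summable (\<lambda>k. inverse (real (k + Suc k0)))" by simp
      then have "summable (\<lambda>k. inverse (real k))" by (rule summable_iff_shift[THEN iffD1])
      then show False using not_summable_harmonic[where 'a = real] by simp
    qed
    moreover have nonneg: "0 \<le> 1 / a (Suc k)" for k using a_ge[of "Suc k"] by simp
    ultimately have unbounded: "\<exists>n. z < (\<Sum>k<n. 1 / a (Suc k))" for z
      using summableI_nonneg_bounded[of "\<lambda>k. 1 / a (Suc k)" z] by (meson not_less)
    show ?thesis
      unfolding filterlim_at_top
    proof
      fix z
      obtain n0 where n0: "z < (\<Sum>k<n0. 1 / a (Suc k))" using unbounded by blast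
      show "eventually (\<lambda>n. z \<le> (\<Sum>k<n. 1 / a (Suc k))) sequentially"
        using eventually_ge_at_top[of n0]
      proof eventually_elim
        case (elim n)
        then have "(\<Sum>k<n0. 1 / a (Suc k)) \<le> (\<Sum>k<n. 1 / a (Suc k))"
          using nonneg by (intro sum_mono2) auto
        with n0 show ?case by simp
      qed
    qed
  qed
  have "prob (\<Inter>n. H n) \<le> 0"
  proof (rule tendsto_lowerbound)
    show "(\<lambda>n. exp (- (\<Sum>k<n. 1 / a (Suc k)))) \<longlonglongrightarrow> 0"
      by (intro filterlim_compose[OF exp_at_bot] filterlim_uminus_at_bot[THEN iffD2]) (use diverge in simp)
    show "eventually (\<lambda>n. prob (\<Inter>n. H n) \<le> exp (- (\<Sum>k<n. 1 / a (Suc k)))) sequentially"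
      using H_event
      by (intro always_eventually allI order_trans[OF finite_measure_mono H_le]) auto
  qed simp
  then have "prob (\<Inter>n. H n) = 0" using measure_nonneg[of P "\<Inter>n. H n"] by linarith
  then have "(\<Inter>n. H n) \<in> null_sets P"
    using H_event by (auto simp: null_sets_def emeasure_eq_measure)
  then show ?thesis
  proof (rule AE_I'[OF _ subsetI])
    fix \<omega> assume "\<omega> \<in> {\<omega>\<in>space P. \<not> first_gap l (N \<omega>) < \<infinity>}"
    then have \<omega>: "\<omega> \<in> space P" "first_gap l (N \<omega>) = \<infinity>" by auto
    have "\<exists>y\<in>N \<omega>. a k < y \<and> y < a k + l" for k
      using first_gap_infinite_iff[OF points_locally_finite[OF \<omega>(1)] points_pos[OF \<omega>(1)]] \<omega>(2) a_ge[of k]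
      by auto
    then have "N \<omega> \<inter> I k \<noteq> {}" for k by (force simp: I_def a_Suc)
    then have "card (N \<omega> \<inter> I k) \<noteq> 0" for k
      using finite_points_bounded[OF \<omega>(1) I(2)[of k "Suc k"]] by (simp only: card_eq_0_iff) simp
    then show "\<omega> \<in> (\<Inter>n. H n)" using \<omega> by (simp add: H_def)
  qed
qed

section \<open>Rapidly growing rates\<close>

text \<open>
  Write \<open>A\<close> for the event that each of the first \<open>K\<close> cells is hit and \<open>B j\<close> for the event that the
  grid window number \<open>j + K\<close> is empty. That window is disjoint from the first \<open>K\<close> cells, hence
  \<open>prob (A \<inter> B j) = prob A * prob (B j)\<close>, and the sum over \<open>j\<close> is at most half of \<open>prob A\<close>. So with
  positive probability \<open>A\<close> occurs and no \<open>B j\<close> does; then all grid windows are hit, and hence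
  all windows of length \<open>l\<close>.
\<close>

lemma prob_first_gap_infinite_pos:
  assumes l: "0 < l" and pos: "AE t in lborel. 0 \<le> t \<longrightarrow> 0 < \<mu> t"
    and c: "1 / l < c" and lower: "eventually (\<lambda>t. c * ln t \<le> \<mu> t) at_top"
  shows "0 < \<P>(\<omega> in P. first_gap l (N \<omega>) = \<infinity>)"
proof -
  have cl: "1 < c * l" using c l by (simp add: field_simps)
  have c0: "0 < c" using c l by (meson divide_pos_pos less_trans zero_less_one)
  obtain T where T: "\<And>t. T \<le> t \<Longrightarrow> c * ln t \<le> \<mu> t"
    using lower by (auto simp: eventually_at_top_linorder)
  \<comment> \<open>With mesh \<open>l / (m + 1)\<close>, every window of length \<open>l\<close> contains \<open>m\<close> consecutive cells,
    of total length \<open>m l / (m + 1)\<close>; \<open>m\<close> is so large that this length times \<open>c\<close> still exceeds 1.\<close>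
  obtain m :: nat where m: "1 / (c * l - 1) < real m" using reals_Archimedean2 by blast
  have m1: "1 \<le> real m"
  proof -
    have "0 < 1 / (c * l - 1)" using cl by simp
    then have "m \<noteq> 0" using m by (intro notI) simp
    then show ?thesis by simp
  qed
  define d where "d = l / real (Suc m)"
  have d: "0 < d" "real m * d + d = l"
  proof -
    show "0 < d" using l by (simp add: d_def)
    have "d * real (Suc m) = l" by (simp add: d_def)
    then show "real m * d + d = l" by (simp add: algebra_simps)
  qed
  define s where "s = c * (real m * d)"
  have s: "1 < s"
  proof -
    have "1 < real m * (c * l - 1)" using m cl by (simp add: field_simps)
    then show ?thesis by (simp add: s_def d_def field_simps)
  qed
  define J where "J j = {real j * d<..real j * d + real m * d}" for j
  define C where "C i = {real i * d<..real (Suc i) * d}" for i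
  have CJ: "C i \<subseteq> J i" for i
  proof -
    have "d \<le> real m * d" using d mult_right_mono[OF m1, of d] by simp
    then have "real (Suc i) * d \<le> real i * d + real m * d" by (simp add: algebra_simps)
    then show ?thesis unfolding C_def J_def by auto
  qed
  have J: "J j \<in> sets borel" "J j \<subseteq> {0<..real j * d + real m * d}" for j
  proof -
    have "0 \<le> real j * d" using d by simp
    then show "J j \<in> sets borel" "J j \<subseteq> {0<..real j * d + real m * d}"
      unfolding J_def by (auto intro: le_less_trans)
  qed
  define p where "p j = \<P>(\<omega> in P. card (N \<omega> \<inter> J j) = 0)" for j
  have p_le: "p j \<le> (real j * d) powr (- s)" if "max T 1 \<le> real j * d" for j
  proof -
    have "p j \<le> exp (- (c * ln (real j * d) * (real j * d + real m * d - real j * d)))"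
      unfolding p_def J_def
    proof (rule prob_void_interval_le)
      fix t assume t: "real j * d < t" "t \<le> real j * d + real m * d"
      have "c * ln (real j * d) \<le> c * ln t" using t that c0 by (intro mult_left_mono) auto
      also have "\<dots> \<le> \<mu> t" using t that by (intro T) auto
      finally show "c * ln (real j * d) \<le> \<mu> t" .
    qed (use that d c0 in auto)
    also have "\<dots> = (real j * d) powr (- s)"
    proof -
      have "real j * d \<noteq> 0" using that by linarith
      then show ?thesis by (simp add: powr_def s_def mult_ac)
    qed
    finally show ?thesis .
  qed
  have "summable p"
  proof (rule summable_comparison_test_ev)
    obtain j0 :: nat where j0: "max T 1 / d < real j0" using reals_Archimedean2 by blast
    show "eventually (\<lambda>j. norm (p j) \<le> d powr (- s) * real j powr (- s)) sequentially"
      using eventually_ge_at_top[of j0]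
    proof eventually_elim
      case (elim j)
      have "max T 1 \<le> real j0 * d" using j0 d by (simp add: field_simps)
      also have "\<dots> \<le> real j * d" using elim d by simp
      finally have "p j \<le> (real j * d) powr (- s)" by (rule p_le)
      moreover have "0 \<le> p j" by (simp add: p_def)
      ultimately show ?case using d by (simp add: powr_mult mult.commute)
    qed
    show "summable (\<lambda>j. d powr (- s) * real j powr (- s))"
      using s by (intro summable_mult) (simp add: summable_real_powr_iff)
  qed
  then obtain K where K: "norm (\<Sum>j. p (j + K)) < 1 / 2"
    using suminf_exist_split[of "1/2" p] by auto
  define A where "A = {\<omega>\<in>space P. \<forall>i<K. card (N \<omega> \<inter> C i) \<in> - {0}}"
  define B where "B j = {\<omega>\<in>space P. card (N \<omega> \<inter> J (j + K)) \<in> {0}}" for j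
  have C: "C i \<in> sets borel" "C i \<subseteq> {0<..real j * d + real m * d}" if "i \<le> j" for i j
  proof -
    have "real i * d \<le> real j * d" using that d by simp
    then have "{0<..real i * d + real m * d} \<subseteq> {0<..real j * d + real m * d}" by auto
    with CJ[of i] J(2)[of i] show "C i \<subseteq> {0<..real j * d + real m * d}" by blast
  qed (simp add: C_def)
  have C_disj: "C i \<inter> C j = {}" if "i < j" for i j
    using that d mult_right_mono[of "real (Suc i)" "real j" d] by (auto simp: C_def)
  have CJ_disj: "C i \<inter> J (j + K) = {}" if "i < K" for i j
    using that d mult_right_mono[of "real (Suc i)" "real (j + K)" d] by (auto simp: C_def J_def)
  have A_event: "A \<in> events"
  proof -
    have "A = {\<omega>\<in>space P. \<forall>k\<in>{..<K}. card (N \<omega> \<inter> C k) \<in> - {0}}" by (auto simp: A_def)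
    also have "\<dots> \<in> events"
      by (intro sets.sets_Collect_finite_All event_count[OF C[OF order_refl]]) auto
    finally show ?thesis .
  qed
  have B_event: "B j \<in> events" for j unfolding B_def by (rule event_count[OF J])
  have A_prob: "prob A = (\<Prod>i<K. \<P>(\<omega> in P. card (N \<omega> \<inter> C i) \<in> - {0}))"
    unfolding A_def
  proof (rule prob_counts_eq_prod)
    show "C i \<in> sets borel \<and> C i \<subseteq> {0<..real K * d + real m * d}" if "i < K" for i
      using C[of i K] that by simp
    show "disjoint_family_on C {..<K}"
      unfolding disjoint_family_on_def by (metis C_disj Int_commute linorder_neqE_nat)
  qed
  have A_pos: "0 < prob A"
    unfolding A_prob
  proof (rule prod_pos)
    fix i
    show "0 < \<P>(\<omega> in P. card (N \<omega> \<inter> C i) \<in> - {0})"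
      using prob_hit_interval_pos[OF pos, of "real i * d" "real (Suc i) * d"] d by (simp add: C_def)
  qed
  have AB: "prob (A \<inter> B j) = prob A * p (j + K)" for j
  proof -
    define E where "E i = (if i < K then C i else J (j + K))" for i
    define Q where "Q i = (if i < K then - {0} else {0::nat})" for i
    have "A \<inter> B j = {\<omega>\<in>space P. \<forall>i<Suc K. card (N \<omega> \<inter> E i) \<in> Q i}"
      by (auto simp: A_def B_def E_def Q_def less_Suc_eq)
    also have "prob \<dots> = (\<Prod>i<Suc K. \<P>(\<omega> in P. card (N \<omega> \<inter> E i) \<in> Q i))"
    proof (rule prob_counts_eq_prod)
      show "E i \<in> sets borel \<and> E i \<subseteq> {0<..real (j + K) * d + real m * d}" if "i < Suc K" for i
      proof (cases "i < K")
        case True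
        then show ?thesis using C[of i "j + K"] by (simp add: E_def)
      next
        case False
        then show ?thesis using J[of "j + K"] by (simp add: E_def)
      qed
      have "E i \<inter> E k = {}" if "i < k" "k < Suc K" for i k
        using that C_disj[of i k] CJ_disj[of i j] by (auto simp: E_def)
      then show "disjoint_family_on E {..<Suc K}"
        unfolding disjoint_family_on_def by (metis Int_commute lessThan_iff linorder_neqE_nat)
    qed
    also have "\<dots> = prob A * p (j + K)" by (simp add: A_prob E_def Q_def p_def)
    finally show ?thesis .
  qed
  have "prob (\<Union>j. A \<inter> B j) \<le> (\<Sum>j. prob (A \<inter> B j))"
    using A_event B_event \<open>summable p\<close>
    by (intro finite_measure_subadditive_countably) (auto simp: AB summable_iff_shift intro: summable_mult)
  also have "\<dots> = prob A * (\<Sum>j. p (j + K))"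
    using \<open>summable p\<close> by (simp add: AB suminf_mult summable_iff_shift)
  also have "\<dots> < prob A * 1" using A_pos K by (intro mult_strict_left_mono) auto
  finally have "0 < prob A - prob (\<Union>j. A \<inter> B j)" by simp
  also have "\<dots> = prob (A - (\<Union>j. A \<inter> B j))"
    using A_event B_event by (intro finite_measure_Diff[symmetric]) auto
  also have "\<dots> \<le> \<P>(\<omega> in P. first_gap l (N \<omega>) = \<infinity>)"
  proof (rule finite_measure_mono[OF subsetI event_first_gap_infinite])
    fix \<omega> assume "\<omega> \<in> A - (\<Union>j. A \<inter> B j)"
    then have \<omega>: "\<omega> \<in> space P" and card1: "\<And>i. i < K \<Longrightarrow> card (N \<omega> \<inter> C i) \<noteq> 0"
      and card2: "\<And>j. card (N \<omega> \<inter> J (j + K)) \<noteq> 0"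
      by (auto simp: A_def B_def)
    have hit1: "N \<omega> \<inter> C i \<noteq> {}" if "i < K" for i using card1[OF that] by force
    have hit2: "N \<omega> \<inter> J (j + K) \<noteq> {}" for j using card2[of j] by force
    have hit: "N \<omega> \<inter> J j \<noteq> {}" for j
    proof (cases "j < K")
      case True then show ?thesis using hit1[of j] CJ[of j] by blast
    next
      case False then show ?thesis using hit2[of "j - K"] by simp
    qed
    have "\<exists>y\<in>N \<omega>. t < y \<and> y < t + l" if "0 \<le> t" for t
    proof -
      \<comment> \<open>The first grid point from \<open>t\<close> on is less than \<open>d\<close> away, which leaves room for its window.\<close>
      define j where "j = nat \<lceil>t / d\<rceil>"
      have "real j = of_int \<lceil>t / d\<rceil>" using that d by (simp add: j_def)
      then have "t / d \<le> real j" "real j < t / d + 1" by linarith+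
      then have "t \<le> real j * d" "real j * d < t + d" using d by (simp_all add: field_simps)
      moreover obtain y where "y \<in> N \<omega>" "y \<in> J j" using hit by blast
      ultimately show ?thesis using d by (intro bexI[of _ y]) (auto simp: J_def)
    qed
    then show "\<omega> \<in> {\<omega>\<in>space P. first_gap l (N \<omega>) = \<infinity>}"
      using first_gap_infinite_iff[OF points_locally_finite[OF \<omega>] points_pos[OF \<omega>]] \<omega> by auto
  qed
  finally show ?thesis .
qed

end

section \<open>The critical growth of the rate\<close>

theorem corollary3p1:
  fixes P :: "'w measure" and N :: "'w \<Rightarrow> real set" and \<mu> :: "real \<Rightarrow> real" and l :: real
  assumes "0 < l"
    and "poisson_point_process P N \<mu>"
    and "AE t in lborel. 0 \<le> t \<longrightarrow> 0 < \<mu> t"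
  shows "(Limsup at_top (\<lambda>t. ereal (\<mu> t / ln t)) < ereal (1 / l) \<longrightarrow>
            (AE \<omega> in P. first_gap l (N \<omega>) < \<infinity>)) \<and>
         (Liminf at_top (\<lambda>t. ereal (\<mu> t / ln t)) > ereal (1 / l) \<longrightarrow>
            \<P>(\<omega> in P. first_gap l (N \<omega>) = \<infinity>) > 0)"
proof (intro conjI impI)
  interpret poisson_point_process P N \<mu> by fact
  {
    assume "Limsup at_top (\<lambda>t. ereal (\<mu> t / ln t)) < ereal (1 / l)"
    then have "eventually (\<lambda>t. ereal (\<mu> t / ln t) < ereal (1 / l)) at_top" by (rule Limsup_lessD)
    then have "eventually (\<lambda>t. \<mu> t \<le> ln t / l) at_top"
      using eventually_gt_at_top[of 1]
      by eventually_elim (use assms(1) in \<open>simp add: field_simps\<close>)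
    then show "AE \<omega> in P. first_gap l (N \<omega>) < \<infinity>" by (rule AE_first_gap_finite[OF assms(1)])
  next
    assume "Liminf at_top (\<lambda>t. ereal (\<mu> t / ln t)) > ereal (1 / l)"
    then obtain c where c: "ereal (1 / l) < ereal c" "ereal c < Liminf at_top (\<lambda>t. ereal (\<mu> t / ln t))"
      using ereal_dense2 by blast
    from c(2) have "eventually (\<lambda>t. ereal c < ereal (\<mu> t / ln t)) at_top" by (rule less_LiminfD)
    then have "eventually (\<lambda>t. c * ln t \<le> \<mu> t) at_top"
      using eventually_gt_at_top[of 1]
      by eventually_elim (simp add: field_simps)
    then show "\<P>(\<omega> in P. first_gap l (N \<omega>) = \<infinity>) > 0"
      using c(1) by (intro prob_first_gap_infinite_pos[OF assms(1,3)]) auto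
  }
qed

end
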